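(* Let $T$ be a transformation of a probability space $(X,\mu)$ preserving $\mu$, and for $f,g\in L_2(X,\mu)$ put $$\mathcal{C}_{f,g}(n):=\left|\int_X\left(f\circ T^{n}\right)\overline{g}\,d\mu-\int_X f\,d\mu\int_X\overline{g}\,d\mu\right| .$$ Then no sequence $\epsilon_n\to0$ can satisfy $$\mathcal{C}_{f,g}(n)\le\epsilon_n\|f\|_{L_2}\|g\|_{L_2}\qquad\text{for all } f,g\in L_2(X,\mu)\text{ and } n\ge0 .$$
   Context: $T^n$ is the $n$-fold iterate of $T:X\to X$; $T$ preserves $\mu$ means $T$ is measurable with $T_*\mu=\mu$. $L_2(X,\mu)$ is the complex Hilbert space of square-integrable functions on $X$, with norm $\|\cdot\|_{L_2}$.
   Formalization: The probability space is assumed non-trivial: some measurable set A has 0 < μ(A) < 1. Without this (e.g. a one-point space) every f in L_2 is a.e. constant, all C_{f,g}(n) vanish, and ε_n = 0 satisfies the bound. *)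

theory Defs
  imports "HOL-Probability.Probability"
begin

definition measure_preserving :: "'a measure \<Rightarrow> ('a \<Rightarrow> 'a) \<Rightarrow> bool" where
  "measure_preserving M T \<longleftrightarrow> T \<in> measurable M M \<and> distr M M T = M"

text \<open>Elements of \<open>L\<^sub>2(M)\<close> are represented by functions rather than by classes modulo
  a.e. equality; the norm and the correlations below depend only on the class
  (for the correlations, when \<open>T\<close> preserves \<open>M\<close>).\<close>

definition L2_space :: "'a measure \<Rightarrow> ('a \<Rightarrow> complex) set" where
  "L2_space M = {f \<in> borel_measurable M. integrable M (\<lambda>x. (cmod (f x))\<^sup>2)}"

definition L2_norm :: "'a measure \<Rightarrow> ('a \<Rightarrow> complex) \<Rightarrow> real" where
  "L2_norm M f = sqrt (\<integral>x. (cmod (f x))\<^sup>2 \<partial>M)"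

definition correlation ::
    "'a measure \<Rightarrow> ('a \<Rightarrow> 'a) \<Rightarrow> ('a \<Rightarrow> complex) \<Rightarrow> ('a \<Rightarrow> complex) \<Rightarrow> nat \<Rightarrow> real" where
  "correlation M T f g n =
     cmod ((\<integral>x. f ((T ^^ n) x) * cnj (g x) \<partial>M) - (\<integral>x. f x \<partial>M) * (\<integral>x. cnj (g x) \<partial>M))"

text \<open>If every event has probability 0 or 1 (for instance on a one-point space), then every
  element of \<open>L\<^sub>2(M)\<close> is a.e. constant and all correlations vanish, so that \<open>\<epsilon> = 0\<close> is
  a uniform rate. This degenerate case has to be excluded.\<close>

definition nontrivial_measure :: "'a measure \<Rightarrow> bool" where
  "nontrivial_measure M \<longleftrightarrow> (\<exists>A\<in>sets M. 0 < measure M A \<and> measure M A < 1)"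

end

theory Submission
  imports Defs
begin

text \<open>A uniform rate would have to hold for test functions \<open>g\<close> that depend on \<open>n\<close>. The choice
  \<open>g = f \<circ> T\<^sup>n\<close> makes the two factors of the correlation integral coincide at time \<open>n\<close>: since \<open>T\<^sup>n\<close>
  preserves the measure, the correlation is \<open>\<parallel>f\<parallel>\<^sup>2 - \<bar>\<integral>f\<bar>\<^sup>2\<close>, the variance of \<open>f\<close>, and the
  norm of \<open>g\<close> is that of \<open>f\<close>. Hence, for \<open>f\<close> of nonzero norm, \<open>\<epsilon> n\<close> is bounded below by the ratio of \<open>\<parallel>f\<parallel>\<^sup>2 - \<bar>\<integral>f\<bar>\<^sup>2\<close>
  to \<open>\<parallel>f\<parallel>\<^sup>2\<close>, which does not depend on \<open>n\<close>. The indicator function of an event of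
  probability \<open>p\<close> with \<open>0 < p < 1\<close> gives the positive lower bound \<open>1 - p\<close>.\<close>

lemma measure_preserving_funpow:
  assumes "measure_preserving M T"
  shows "measure_preserving M (T ^^ n)"
proof (induction n)
  case 0
  show ?case
    by (simp add: measure_preserving_def distr_id2)
next
  case (Suc n)
  have "distr M M (T \<circ> T ^^ n) = distr (distr M M (T ^^ n)) M T"
    using assms Suc by (subst distr_distr) (auto simp: measure_preserving_def)
  with assms Suc show ?case
    by (auto simp: measure_preserving_def comp_def intro: measurable_compose)
qed

lemma integral_comp_measure_preserving:
  fixes f :: "'a \<Rightarrow> 'b::{banach, second_countable_topology}"
  assumes "measure_preserving M S" "f \<in> borel_measurable M"
  shows "(\<integral>x. f (S x) \<partial>M) = (\<integral>x. f x \<partial>M)"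
  using assms integral_distr[of S M M f] by (simp add: measure_preserving_def)

lemma L2_space_comp_measure_preserving:
  assumes "measure_preserving M S" "f \<in> L2_space M"
  shows "(\<lambda>x. f (S x)) \<in> L2_space M"
  using assms integrable_distr[of S M M "\<lambda>x. (cmod (f x))\<^sup>2"]
  by (auto simp: measure_preserving_def L2_space_def)

lemma L2_norm_comp_measure_preserving:
  assumes "measure_preserving M S" "f \<in> L2_space M"
  shows "L2_norm M (\<lambda>x. f (S x)) = L2_norm M f"
proof -
  have "f \<in> borel_measurable M"
    using assms(2) by (simp add: L2_space_def)
  then show ?thesis
    using integral_comp_measure_preserving[OF assms(1), of "\<lambda>x. (cmod (f x))\<^sup>2"]
    by (simp add: L2_norm_def)
qed

text \<open>The two integrals that involve \<open>T\<close> have integrands of the form \<open>h \<circ> T\<^sup>n\<close>, with \<open>h = f \<cdot> cnj f\<close> and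
  \<open>h = cnj f\<close>, so invariance of the measure removes the iterate. What
  remains does not decay in \<open>n\<close>.\<close>

lemma correlation_with_own_iterate:
  assumes T: "measure_preserving M T" and f: "f \<in> L2_space M"
  shows "correlation M T f (\<lambda>x. f ((T ^^ n) x)) n =
           \<bar>(L2_norm M f)\<^sup>2 - (cmod (\<integral>x. f x \<partial>M))\<^sup>2\<bar>"
proof -
  have S: "measure_preserving M (T ^^ n)"
    using T by (rule measure_preserving_funpow)
  have [measurable]: "f \<in> borel_measurable M"
    using f by (simp add: L2_space_def)
  have "(\<integral>x. f ((T ^^ n) x) * cnj (f ((T ^^ n) x)) \<partial>M) = (\<integral>x. f x * cnj (f x) \<partial>M)"
    by (rule integral_comp_measure_preserving[OF S])
      (intro borel_measurable_times borel_measurable_continuous_on[of cnj] continuous_intros,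
        measurable)
  also have "\<dots> = (\<integral>x. complex_of_real ((cmod (f x))\<^sup>2) \<partial>M)"
    by (simp only: complex_norm_square)
  also have "\<dots> = complex_of_real ((L2_norm M f)\<^sup>2)"
    by (simp only: integral_complex_of_real) (simp add: L2_norm_def)
  finally have product: "(\<integral>x. f ((T ^^ n) x) * cnj (f ((T ^^ n) x)) \<partial>M) =
      complex_of_real ((L2_norm M f)\<^sup>2)" .
  have "(\<integral>x. cnj (f ((T ^^ n) x)) \<partial>M) = cnj (\<integral>x. f x \<partial>M)"
    using integral_comp_measure_preserving[OF S, of f] by simp
  then have means: "(\<integral>x. f x \<partial>M) * (\<integral>x. cnj (f ((T ^^ n) x)) \<partial>M) =
      complex_of_real ((cmod (\<integral>x. f x \<partial>M))\<^sup>2)"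
    by (simp only: complex_norm_square)
  show ?thesis
    unfolding correlation_def product means of_real_diff[symmetric] norm_of_real ..
qed

theorem corollaryD2:
  fixes M :: "'a measure" and T :: "'a \<Rightarrow> 'a"
  assumes "prob_space M"
    and "nontrivial_measure M"
    and "measure_preserving M T"
  shows "\<not> (\<exists>\<epsilon> :: nat \<Rightarrow> real. \<epsilon> \<longlonglongrightarrow> 0 \<and>
           (\<forall>f\<in>L2_space M. \<forall>g\<in>L2_space M. \<forall>n.
              correlation M T f g n \<le> \<epsilon> n * L2_norm M f * L2_norm M g))"
proof
  interpret prob_space M by fact
  assume "\<exists>\<epsilon> :: nat \<Rightarrow> real. \<epsilon> \<longlonglongrightarrow> 0 \<and>
           (\<forall>f\<in>L2_space M. \<forall>g\<in>L2_space M. \<forall>n.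
              correlation M T f g n \<le> \<epsilon> n * L2_norm M f * L2_norm M g)"
  then obtain \<epsilon> :: "nat \<Rightarrow> real" where lim: "\<epsilon> \<longlonglongrightarrow> 0"
    and rate: "\<And>f g n. f \<in> L2_space M \<Longrightarrow> g \<in> L2_space M \<Longrightarrow>
                 correlation M T f g n \<le> \<epsilon> n * L2_norm M f * L2_norm M g"
    by blast
  obtain A where A [measurable]: "A \<in> sets M" and p: "0 < prob A" "prob A < 1"
    using assms(2) by (auto simp: nontrivial_measure_def)
  define f :: "'a \<Rightarrow> complex" where "f = (\<lambda>x. complex_of_real (indicator A x))"
  have square: "(cmod (f x))\<^sup>2 = indicator A x" for x
    by (simp add: f_def indicator_def)
  have f: "f \<in> L2_space M"
  proof -
    have "f \<in> borel_measurable M"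
      unfolding f_def by measurable
    then show ?thesis
      by (simp add: L2_space_def square integrable_indicator_iff less_top[symmetric])
  qed
  have norm: "(L2_norm M f)\<^sup>2 = prob A"
    unfolding L2_norm_def square by simp
  have mean: "(\<integral>x. f x \<partial>M) = complex_of_real (prob A)"
    unfolding f_def integral_complex_of_real by simp
  have "1 - prob A \<le> \<epsilon> n" for n
  proof -
    have S: "measure_preserving M (T ^^ n)"
      using assms(3) by (rule measure_preserving_funpow)
    have "prob A * (1 - prob A) = prob A - (prob A)\<^sup>2"
      by (simp add: algebra_simps power2_eq_square)
    also have "\<dots> \<le> correlation M T f (\<lambda>x. f ((T ^^ n) x)) n"
      by (simp add: correlation_with_own_iterate[OF assms(3) f] norm mean)
    also have "\<dots> \<le> \<epsilon> n * L2_norm M f * L2_norm M (\<lambda>x. f ((T ^^ n) x))"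
      by (rule rate[OF f L2_space_comp_measure_preserving[OF S f]])
    also have "\<dots> = prob A * \<epsilon> n"
      by (simp add: L2_norm_comp_measure_preserving[OF S f] flip: norm)
        (simp add: power2_eq_square)
    finally show ?thesis
      using p(1) by simp
  qed
  then have "1 - prob A \<le> 0"
    using lim by (intro LIMSEQ_le_const) auto
  with p(2) show False
    by simp
qed

end
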